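(* Let $n,m\ge 2$ be integers, and regard $C_{2n}\times C_{2m}$ as a subgraph of $M(C_{2n})\times M(C_{2m})$ (via the natural inclusion of $C_{2n}$ into $M(C_{2n})$ and of $C_{2m}$ into $M(C_{2m})$, whose original vertices are kept). If $(u,v)$ is a vertex of $M(C_{2n})\times M(C_{2m})$ with $(u,v)\notin V(C_{2n}\times C_{2m})$, then $$f\big(M(C_{2n})\times M(C_{2m}),(u,v)\big)\le f\big(M(C_{2n})\big)\,f\big(M(C_{2m})\big).$$
   Context: A distribution of pebbles on a graph assigns a nonnegative integer number of pebbles to each vertex. A pebbling move removes two pebbles from a vertex and places one pebble on an adjacent vertex. For a connected graph $G$ and a vertex $v$, $f(G,v)$ is the smallest integer $N$ such that from every distribution of $N$ pebbles on $G$ one pebble can be moved to $v$ by a sequence of pebbling moves; $f(G)=\max_{v\in V(G)} f(G,v)$. $C_k$ denotes the cycle on $k$ vertices. The middle graph $M(G)$ of a graph $G$ is obtained from $G$ by inserting a new vertex into each edge of $G$ (subdividing it), and joining two new vertices by an edge whenever the two edges of $G$ they were inserted into share a common endpoint; the original vertices of $G$ are vertices of $M(G)$. For graphs $G_1,G_2$, the Cartesian product $G_1\times G_2$ has vertex set $V(G_1)\times V(G_2)$, with $(u_1,v_1)$ adjacent to $(u_2,v_2)$ iff either $u_1=u_2$ and $v_1v_2\in E(G_2)$, or $u_1u_2\in E(G_1)$ and $v_1=v_2$. Thus a vertex $(u,v)$ of $M(C_{2n})\times M(C_{2m})$ lies outside $C_{2n}\times C_{2m}$ exactly when $u$ or $v$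 is one of the inserted (subdivision) vertices. *)

theory Defs
  imports "Graph_Theory.Pair_Digraph"
begin

text \<open>
  Finite simple graphs are \<^locale>\<open>pair_graph\<close>s: symmetric loop-free arc sets, an undirected
  edge between \<open>u\<close> and \<open>v\<close> being the two arcs \<open>(u, v)\<close> and \<open>(v, u)\<close>.
\<close>

definition edge_sets :: "'a pair_pre_digraph \<Rightarrow> 'a set set" where
  "edge_sets G = {{u, v} | u v. (u, v) \<in> parcs G}"

text \<open>A cycle in the usual sense only for \<open>k \<ge> 3\<close>.\<close>

definition cycle_graph :: "nat \<Rightarrow> nat pair_pre_digraph" where
  "cycle_graph k =
     \<lparr> pverts = {..<k},
       parcs = {(i, j). i < k \<and> j < k \<and> (j = Suc i mod k \<or> i = Suc j mod k)} \<rparr>"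

text \<open>\<open>Inl x\<close> is the original vertex \<open>x\<close>, \<open>Inr e\<close> the vertex inserted into the edge \<open>e\<close>.\<close>

definition middle_graph :: "'a pair_pre_digraph \<Rightarrow> ('a + 'a set) pair_pre_digraph" where
  "middle_graph G =
     \<lparr> pverts = Inl ` pverts G \<union> Inr ` edge_sets G,
       parcs = {(Inl x, Inr e) | x e. e \<in> edge_sets G \<and> x \<in> e}
             \<union> {(Inr e, Inl x) | x e. e \<in> edge_sets G \<and> x \<in> e}
             \<union> {(Inr e, Inr e') | e e'. e \<in> edge_sets G \<and> e' \<in> edge_sets G \<and>
                                         e \<noteq> e' \<and> e \<inter> e' \<noteq> {}} \<rparr>"

definition cart_prod ::
  "'a pair_pre_digraph \<Rightarrow> 'b pair_pre_digraph \<Rightarrow> ('a \<times> 'b) pair_pre_digraph" where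
  "cart_prod G H =
     \<lparr> pverts = pverts G \<times> pverts H,
       parcs = {((u1, v1), (u2, v2)) | u1 v1 u2 v2.
                  u1 = u2 \<and> u1 \<in> pverts G \<and> (v1, v2) \<in> parcs H \<or>
                  (u1, u2) \<in> parcs G \<and> v1 = v2 \<and> v1 \<in> pverts H} \<rparr>"

definition distribution :: "'a pair_pre_digraph \<Rightarrow> nat \<Rightarrow> ('a \<Rightarrow> nat) \<Rightarrow> bool" where
  "distribution G N p \<longleftrightarrow> (\<forall>x. x \<notin> pverts G \<longrightarrow> p x = 0) \<and> (\<Sum>x\<in>pverts G. p x) = N"

definition pebbling_move :: "'a pair_pre_digraph \<Rightarrow> ('a \<Rightarrow> nat) \<Rightarrow> ('a \<Rightarrow> nat) \<Rightarrow> bool" where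
  "pebbling_move G p q \<longleftrightarrow>
     (\<exists>x y. (x, y) \<in> parcs G \<and> 2 \<le> p x \<and> q = p(x := p x - 2, y := p y + 1))"

text \<open>The sequence of moves may be empty, so a pebble already lying on \<open>v\<close> counts.\<close>

definition can_reach :: "'a pair_pre_digraph \<Rightarrow> ('a \<Rightarrow> nat) \<Rightarrow> 'a \<Rightarrow> bool" where
  "can_reach G p v \<longleftrightarrow> (\<exists>q. (pebbling_move G)\<^sup>*\<^sup>* p q \<and> 1 \<le> q v)"

text \<open>For a finite connected \<open>G\<close> and \<open>v \<in> pverts G\<close> such an \<open>N\<close> exists.\<close>

definition pebbling_number_at :: "'a pair_pre_digraph \<Rightarrow> 'a \<Rightarrow> nat" where
  "pebbling_number_at G v = (LEAST N. \<forall>p. distribution G N p \<longrightarrow> can_reach G p v)"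

definition pebbling_number :: "'a pair_pre_digraph \<Rightarrow> nat" where
  "pebbling_number G = Max (pebbling_number_at G ` pverts G)"

lemma pair_graph_cycle_graph:
  assumes "3 \<le> k"
  shows "pair_graph (cycle_graph k)"
proof
  show "finite (parcs (cycle_graph k))"
    by (rule finite_subset[of _ "{..<k} \<times> {..<k}"]) (auto simp: cycle_graph_def)
  show "symmetric (with_proj (cycle_graph k))"
    by (auto simp: symmetric_def sym_def cycle_graph_def)
  have "Suc i mod k \<noteq> i" if "i < k" for i
    using assms that by (cases "Suc i = k") auto
  then show "fst e \<noteq> snd e" if "e \<in> parcs (cycle_graph k)" for e
    using that by (fastforce simp: cycle_graph_def)
qed (auto simp: cycle_graph_def)

lemma pair_graph_middle_graph:
  assumes "pair_graph G"
  shows "pair_graph (middle_graph G)"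
proof -
  interpret pair_graph G by fact
  have verts: "x \<in> pverts G" if "e \<in> edge_sets G" "x \<in> e" for x e
    using that by (auto simp: edge_sets_def dest: in_arcsD1 in_arcsD2)
  have "edge_sets G = (\<lambda>(u, v). {u, v}) ` parcs G"
    by (auto simp: edge_sets_def)
  then have fin: "finite (edge_sets G)"
    using pair_finite_arcs by simp
  show ?thesis
  proof
    show fv: "finite (pverts (middle_graph G))"
      using fin pair_finite_verts by (simp add: middle_graph_def)
    show "finite (parcs (middle_graph G))"
      by (rule finite_subset[OF _ finite_cartesian_product[OF fv fv]])
        (auto simp: middle_graph_def dest: verts)
    show "symmetric (with_proj (middle_graph G))"
      by (auto simp: symmetric_def sym_def middle_graph_def)
  qed (auto simp: middle_graph_def dest: verts)
qed

lemma pair_graph_cart_prod: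
  assumes "pair_graph G" "pair_graph H"
  shows "pair_graph (cart_prod G H)"
proof -
  interpret G: pair_graph G by fact
  interpret H: pair_graph H by fact
  have sG: "(v, u) \<in> parcs G" if "(u, v) \<in> parcs G" for u v
    using that G.pair_sym_arcs by (auto simp: symmetric_def sym_def)
  have sH: "(v, u) \<in> parcs H" if "(u, v) \<in> parcs H" for u v
    using that H.pair_sym_arcs by (auto simp: symmetric_def sym_def)
  show ?thesis
  proof
    show fv: "finite (pverts (cart_prod G H))"
      using G.pair_finite_verts H.pair_finite_verts by (simp add: cart_prod_def)
    show "finite (parcs (cart_prod G H))"
      by (rule finite_subset[OF _ finite_cartesian_product[OF fv fv]])
        (auto simp: cart_prod_def dest: G.in_arcsD1 G.in_arcsD2 H.in_arcsD1 H.in_arcsD2)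
    show "symmetric (with_proj (cart_prod G H))"
      by (auto simp: symmetric_def sym_def cart_prod_def dest: sG sH)
  qed (auto simp: cart_prod_def dest: G.in_arcsD1 G.in_arcsD2 H.in_arcsD1 H.in_arcsD2
        G.pair_no_loops H.pair_no_loops)
qed

end

theory Submission
  imports Defs
begin

text \<open>
  By symmetry let \<open>u\<close> be an inserted vertex of \<open>G = M(C\<^bsub>2n\<^esub>)\<close>. All vertices of \<open>G\<close> lie within distance
  \<open>n\<close> of \<open>u\<close>, while \<open>f(G) \<ge> 2\<^bsup>n+1\<^esup> + 2n - 2\<close> because original vertices can be at distance \<open>n + 1\<close>; this slack
  pays for crude strategies in the product with \<open>H = M(C\<^bsub>2m\<^esub>)\<close>. In \<open>H\<close>, weighted trees show that
  \<open>2\<^bsup>m+1\<^esup> c + 2m - 2\<close> pebbles suffice to put \<open>c\<close> of them on any vertex. If a configuration on the product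
  is unsolvable, then pushing the pebbles of all rows into the fiber over \<open>u\<close> along a breadth first tree
  of \<open>G\<close>, and pushing the three fibers farthest from \<open>u\<close> into the row of \<open>v\<close> first, gives two linear
  inequalities whose average bounds the number of pebbles below \<open>f(G) f(H)\<close>.
\<close>

section \<open>Pebbling moves and weighted trees\<close>

abbreviation reach :: "'a pair_pre_digraph \<Rightarrow> ('a \<Rightarrow> nat) \<Rightarrow> ('a \<Rightarrow> nat) \<Rightarrow> bool" where
  "reach G \<equiv> (pebbling_move G)\<^sup>*\<^sup>*"

lemma pebbling_move_frame:
  assumes "pebbling_move G p q"
  shows "pebbling_move G (\<lambda>x. p x + s x) (\<lambda>x. q x + s x)"
proof -
  from assms obtain x y where "(x, y) \<in> parcs G" "2 \<le> p x" "q = p(x := p x - 2, y := p y + 1)"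
    by (auto simp: pebbling_move_def)
  then show ?thesis
    unfolding pebbling_move_def by (intro exI[of _ x] exI[of _ y]) (auto simp: fun_eq_iff)
qed

lemma reach_frame:
  assumes "reach G p q"
  shows "reach G (\<lambda>x. p x + s x) (\<lambda>x. q x + s x)"
  using assms
proof (induction rule: rtranclp_induct)
  case (step q q')
  then show ?case
    using pebbling_move_frame[OF step.hyps(2), of s] by (auto intro: rtranclp.rtrancl_into_rtrancl)
qed simp

lemma can_reach_mono:
  assumes "can_reach G p v" "\<And>x. p x \<le> p' x"
  shows "can_reach G p' v"
proof -
  from assms(1) obtain q where q: "reach G p q" "1 \<le> q v"
    by (auto simp: can_reach_def)
  have "p' = (\<lambda>x. p x + (p' x - p x))"
    using assms(2) by (simp add: fun_eq_iff)
  then have "reach G p' (\<lambda>x. q x + (p' x - p x))"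
    using reach_frame[OF q(1), of "\<lambda>x. p' x - p x"] by simp
  with q(2) show ?thesis
    unfolding can_reach_def by (metis trans_le_add1)
qed

lemma can_reach_if_reach:
  assumes "reach G p q" "can_reach G q v"
  shows "can_reach G p v"
  using assms unfolding can_reach_def by (meson rtranclp_trans)

lemma can_reachI:
  assumes "reach G p q" "0 < q v"
  shows "can_reach G p v"
  using assms unfolding can_reach_def by (metis One_nat_def Suc_leI)

lemma reach_along_arc:
  assumes "(x, y) \<in> parcs G" "x \<noteq> y" "2 * c \<le> p x"
  shows "reach G p (p(x := p x - 2 * c, y := p y + c))"
  using assms(3)
proof (induction c)
  case (Suc c)
  let ?q = "p(x := p x - 2 * c, y := p y + c)"
  have "pebbling_move G ?q (?q(x := ?q x - 2, y := ?q y + 1))"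
    unfolding pebbling_move_def
    by (intro exI[of _ x] exI[of _ y]) (use assms(1,2) Suc.prems in auto)
  moreover have "?q(x := ?q x - 2, y := ?q y + 1) = p(x := p x - 2 * Suc c, y := p y + Suc c)"
    using assms(2) by (auto simp: fun_eq_iff)
  moreover have "reach G p ?q"
    by (rule Suc.IH) (use Suc.prems in simp)
  ultimately show ?case
    by (metis (no_types, lifting) rtranclp.rtrancl_into_rtrancl)
qed simp

text \<open>
  Emptying a leaf of minimal weight into its parent loses at most the weight of one pebble.
\<close>

lemma weight_function:
  fixes w :: "'i \<Rightarrow> nat"
  assumes "finite X" "r \<in> X" "inj_on g X" "\<And>z. z \<in> X \<Longrightarrow> 0 < w z"
    and "\<And>z. z \<in> X \<Longrightarrow> z \<noteq> r \<Longrightarrow>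
           par z \<in> X \<and> (g z, g (par z)) \<in> parcs G \<and> 2 * w z \<le> w (par z)"
  shows "\<exists>q. reach G p q \<and> (\<Sum>z\<in>X. w z * p (g z)) \<le> w r * q (g r) + (\<Sum>z\<in>X - {r}. w z)"
  using assms
proof (induction "card X" arbitrary: X p)
  case (Suc n)
  show ?case
  proof (cases "X = {r}")
    case True
    then show ?thesis by auto
  next
    case False
    then have "X - {r} \<noteq> {}" using Suc.prems(2) by auto
    then obtain z where z: "z \<in> X" "z \<noteq> r" and min: "\<And>z'. z' \<in> X - {r} \<Longrightarrow> w z \<le> w z'"
      using ex_is_arg_min_if_finite[of "X - {r}" w] Suc.prems(1)
      by (auto simp: is_arg_min_linorder)
    let ?y = "par z" and ?X = "X - {z}" and ?c = "p (g z) div 2"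
    have y: "?y \<in> X" "(g z, g ?y) \<in> parcs G" "2 * w z \<le> w ?y" and "?y \<noteq> z"
      using Suc.prems(5)[OF z] Suc.prems(4)[OF z(1)] by auto
    then have gy: "g z \<noteq> g ?y"
      using Suc.prems(3) z(1) by (metis inj_onD)
    let ?p = "p(g z := p (g z) - 2 * ?c, g ?y := p (g ?y) + ?c)"
    have "\<exists>q. reach G ?p q \<and> (\<Sum>z\<in>?X. w z * ?p (g z)) \<le> w r * q (g r) + (\<Sum>z\<in>?X - {r}. w z)"
    proof (rule Suc.hyps(1))
      show "n = card ?X" using Suc.hyps(2) z(1) Suc.prems(1) by simp
      fix z' assume z': "z' \<in> ?X" "z' \<noteq> r"
      then have "par z' \<in> X" "(g z', g (par z')) \<in> parcs G" "2 * w z' \<le> w (par z')" "0 < w z'"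
        using Suc.prems(4,5) by auto
      moreover from this have "par z' \<noteq> z"
        using min[of z'] z' by auto
      ultimately show "par z' \<in> ?X \<and> (g z', g (par z')) \<in> parcs G \<and> 2 * w z' \<le> w (par z')"
        by simp
    qed (use Suc.prems z in \<open>auto simp: inj_on_diff\<close>)
    then obtain q where q: "reach G ?p q"
      "(\<Sum>z\<in>?X. w z * ?p (g z)) \<le> w r * q (g r) + (\<Sum>z\<in>?X - {r}. w z)"
      by blast
    have pX: "?p (g x) = p (g x) + (if x = ?y then ?c else 0)" if "x \<in> ?X" for x
    proof -
      have "g x \<noteq> g z" "g x = g ?y \<longleftrightarrow> x = ?y"
        using that z(1) y(1) Suc.prems(3) by (auto dest: inj_onD)
      then show ?thesis by auto
    qed
    have "(\<Sum>x\<in>?X. w x * ?p (g x)) = (\<Sum>x\<in>?X. w x * p (g x) + (if x = ?y then w ?y * ?c else 0))"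
      by (rule sum.cong[OF refl]) (simp only: pX, auto simp: algebra_simps)
    also have "\<dots> = (\<Sum>x\<in>?X. w x * p (g x)) + w ?y * ?c"
      using y(1) \<open>?y \<noteq> z\<close> Suc.prems(1) by (simp add: sum.distrib)
    finally have 1: "(\<Sum>x\<in>?X. w x * ?p (g x)) = (\<Sum>x\<in>?X. w x * p (g x)) + w ?y * ?c" .
    have 2: "(\<Sum>x\<in>X. w x * p (g x)) = w z * p (g z) + (\<Sum>x\<in>?X. w x * p (g x))"
      by (rule sum.remove) (use Suc.prems z in auto)
    have 3: "(\<Sum>z\<in>X - {r}. w z) = w z + (\<Sum>z\<in>?X - {r}. w z)"
      using sum.remove[of "X - {r}" z w] Suc.prems(1) z by (simp add: set_diff_eq conj_ac)
    \<comment> \<open>At most one pebble stays behind on the leaf; this is the whole loss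
      \<open>w z\<close> of the step.\<close>
    have "w z * p (g z) \<le> w z * (2 * ?c + 1)"
      by (rule mult_left_mono) auto
    also have "\<dots> \<le> w ?y * ?c + w z"
      using mult_right_mono[OF y(3), of ?c] by (simp add: algebra_simps)
    finally have "(\<Sum>z\<in>X. w z * p (g z)) \<le> w r * q (g r) + (\<Sum>z\<in>X - {r}. w z)"
      using 1 2 3 q(2) by linarith
    moreover have "reach G p q"
      using reach_along_arc[OF y(2) gy, of ?c p] q(1) by (simp add: rtranclp_trans)
    ultimately show ?thesis by blast
  qed
qed auto

section \<open>Lifting moves from the factors to rows and columns of the product\<close>

lemma reach_row:
  assumes "y \<in> pverts H" "reach G (\<lambda>x. P (x, y)) q"
  shows "reach (cart_prod G H) P (\<lambda>(x, y'). if y' = y then q x else P (x, y'))"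
  using assms(2)
proof (induction rule: rtranclp_induct)
  case base
  have "(\<lambda>(x, y'). if y' = y then P (x, y) else P (x, y')) = P"
    by (auto simp: fun_eq_iff)
  then show ?case by simp
next
  case (step q q')
  let ?L = "\<lambda>q (x, y'). if y' = y then q x else P (x, y')"
  from step.hyps(2) obtain a b where ab: "(a, b) \<in> parcs G" "2 \<le> q a"
    "q' = q(a := q a - 2, b := q b + 1)"
    by (auto simp: pebbling_move_def)
  have "pebbling_move (cart_prod G H) (?L q) (?L q')"
    unfolding pebbling_move_def
    by (intro exI[of _ "(a, y)"] exI[of _ "(b, y)"])
      (use ab assms(1) in \<open>auto simp: cart_prod_def fun_eq_iff\<close>)
  then show ?case by (rule rtranclp.rtrancl_into_rtrancl[OF step.IH])
qed

lemma reach_rows: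
  assumes "finite Y" "Y \<subseteq> pverts H" "\<And>y. y \<in> Y \<Longrightarrow> reach G (\<lambda>x. P (x, y)) (q y)"
  shows "reach (cart_prod G H) P (\<lambda>(x, y). if y \<in> Y then q y x else P (x, y))"
  using assms
proof (induction Y rule: finite_induct)
  case empty
  have "(\<lambda>(x, y). P (x, y)) = P" by auto
  then show ?case by simp
next
  case (insert y Y)
  let ?Q = "\<lambda>Y (x, y). if y \<in> Y then q y x else P (x, y)"
  have "reach (cart_prod G H) P (?Q Y)"
    using insert by simp
  also have "reach G (\<lambda>x. ?Q Y (x, y)) (q y)"
    using insert by simp
  then have "reach (cart_prod G H) (?Q Y) (\<lambda>(x, y'). if y' = y then q y x else ?Q Y (x, y'))"
    using insert by (intro reach_row) auto
  also have "(\<lambda>(x, y'). if y' = y then q y x else ?Q Y (x, y')) = ?Q (insert y Y)"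
    by (auto simp: fun_eq_iff)
  finally show ?case .
qed

lemma reach_swap:
  assumes "reach (cart_prod G H) P Q"
  shows "reach (cart_prod H G) (P \<circ> prod.swap) (Q \<circ> prod.swap)"
  using assms
proof (induction rule: rtranclp_induct)
  case (step Q Q')
  from step.hyps(2) obtain a b c d where "((a, b), (c, d)) \<in> parcs (cart_prod G H)" "2 \<le> Q (a, b)"
    "Q' = Q((a, b) := Q (a, b) - 2, (c, d) := Q (c, d) + 1)"
    unfolding pebbling_move_def by (metis surj_pair)
  then have "pebbling_move (cart_prod H G) (Q \<circ> prod.swap) (Q' \<circ> prod.swap)"
    unfolding pebbling_move_def
    by (intro exI[of _ "(b, a)"] exI[of _ "(d, c)"]) (auto simp: cart_prod_def fun_eq_iff)
  then show ?case by (rule rtranclp.rtrancl_into_rtrancl[OF step.IH])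
qed simp

lemma can_reach_swap:
  assumes "can_reach (cart_prod G H) P (x, y)"
  shows "can_reach (cart_prod H G) (P \<circ> prod.swap) (y, x)"
  using assms reach_swap unfolding can_reach_def by fastforce

text \<open>Exchanging the factors turns columns into rows.\<close>

lemma reach_columns:
  assumes "finite X" "X \<subseteq> pverts G" "\<And>x. x \<in> X \<Longrightarrow> reach H (\<lambda>y. P (x, y)) (q x)"
  shows "reach (cart_prod G H) P (\<lambda>(x, y). if x \<in> X then q x y else P (x, y))"
proof -
  have "reach (cart_prod H G) (P \<circ> prod.swap) (\<lambda>(y, x). if x \<in> X then q x y else (P \<circ> prod.swap) (y, x))"
    using assms by (intro reach_rows) auto
  moreover have "(\<lambda>(y, x). if x \<in> X then q x y else (P \<circ> prod.swap) (y, x)) \<circ> prod.swap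
      = (\<lambda>(x, y). if x \<in> X then q x y else P (x, y))" "P \<circ> prod.swap \<circ> prod.swap = P"
    by (auto simp: fun_eq_iff)
  ultimately show ?thesis
    using reach_swap by fastforce
qed

section \<open>Middle graphs of even cycles\<close>

text \<open>
  The shape of \<open>M(C\<^bsub>2n\<^esub>)\<close>: a cycle of inserted vertices \<open>E i\<close> with an original vertex \<open>V i\<close>
  joined to both \<open>E (i - 1)\<close> and \<open>E i\<close>, all indices being read modulo \<open>2n\<close>.
\<close>

locale sun =
  fixes G :: "'a pair_pre_digraph" and n :: nat and V E :: "int \<Rightarrow> 'a"
  assumes two_le: "2 \<le> n"
    and verts: "pverts G = range V \<union> range E"
    and V_eq: "V i = V j \<longleftrightarrow> i mod (2 * int n) = j mod (2 * int n)"
    and E_eq: "E i = E j \<longleftrightarrow> i mod (2 * int n) = j mod (2 * int n)"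
    and V_ne_E: "V i \<noteq> E j"
    and arc_EE: "(E i, E (i + 1)) \<in> parcs G" "(E (i + 1), E i) \<in> parcs G"
    and arc_VE: "(V i, E i) \<in> parcs G" "(E i, V i) \<in> parcs G" "(V (i + 1), E i) \<in> parcs G"
      "(E i, V (i + 1)) \<in> parcs G"
begin

lemma sun_shift: "sun G n (\<lambda>i. V (c + i)) (\<lambda>i. E (c + i))"
proof -
  have *: "(c + i) mod M = (c + j) mod M \<longleftrightarrow> i mod M = j mod M" for i j M :: int
    by (simp add: mod_eq_dvd_iff)
  have "range (\<lambda>i. V (c + i)) = range V" "range (\<lambda>i. E (c + i)) = range E"
    by (metis (no_types) surj_plus range_composition image_image)+
  then show ?thesis
    using two_le verts V_ne_E arc_EE[of "c + _"] arc_VE[of "c + _"]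
    by unfold_locales (simp_all add: V_eq E_eq * add.assoc[symmetric])
qed


text \<open>The vertices \<open>V i\<close> and \<open>V (i + 1)\<close> around \<open>E i\<close>
  go to \<open>V (c - i)\<close> and \<open>V (c - i - 1)\<close>, whose common inserted neighbour
  has index \<open>c - 1 - i\<close>. This carries strategies for one side of the cycle over to the
  other side.\<close>

lemma sun_reflect: "sun G n (\<lambda>i. V (c - i)) (\<lambda>i. E (c - 1 - i))"
proof -
  have *: "(c - i) mod M = (c - j) mod M \<longleftrightarrow> i mod M = j mod M" for c i j M :: int
    by (simp add: mod_eq_dvd_iff dvd_diff_commute)
  have r: "range (\<lambda>i. f (c - i)) = range f" for f :: "int \<Rightarrow> 'a" and c
    by (auto simp: image_iff) (metis diff_diff_eq2 add_diff_cancel_left')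
  have e: "(E (c - 1 - i), E (c - 1 - (i + 1))) \<in> parcs G"
    "(E (c - 1 - (i + 1)), E (c - 1 - i)) \<in> parcs G" for i
    using arc_EE[of "c - 1 - (i + 1)"] by (simp_all add: algebra_simps)
  have v: "(V (c - i), E (c - 1 - i)) \<in> parcs G" "(E (c - 1 - i), V (c - i)) \<in> parcs G"
    "(V (c - (i + 1)), E (c - 1 - i)) \<in> parcs G" "(E (c - 1 - i), V (c - (i + 1))) \<in> parcs G" for i
    using arc_VE[of "c - 1 - i"] by (simp_all add: algebra_simps)
  show ?thesis
    by unfold_locales (use two_le verts V_ne_E in \<open>simp_all only: V_eq E_eq * r e v not_False_eq_True\<close>)
qed

lemma window_inj:
  assumes "i \<in> {a<..a + 2 * int n}" "j \<in> {a<..a + 2 * int n}" "i mod (2 * int n) = j mod (2 * int n)"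
  shows "i = j"
proof (rule ccontr)
  assume "i \<noteq> j"
  have "2 * int n dvd i - j"
    using assms(3) by (simp add: mod_eq_dvd_iff)
  then have "2 * int n \<le> \<bar>i - j\<bar>"
    using \<open>i \<noteq> j\<close> by (metis abs_ge_self dvd_imp_le_int order_trans eq_iff_diff_eq_0)
  then show False using assms(1,2) by auto
qed

lemma window_surj:
  obtains j where "j \<in> {a<..a + 2 * int n}" "i mod (2 * int n) = j mod (2 * int n)"
proof
  let ?j = "a + 1 + (i - a - 1) mod (2 * int n)"
  have "0 \<le> (i - a - 1) mod (2 * int n)" "(i - a - 1) mod (2 * int n) < 2 * int n"
    using two_le by simp_all
  then show "?j \<in> {a<..a + 2 * int n}" by simp
  have "?j mod (2 * int n) = (a + 1 + (i - a - 1)) mod (2 * int n)"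
    by (rule mod_add_right_eq)
  then show "i mod (2 * int n) = ?j mod (2 * int n)" by simp
qed

lemma image_window: "range V = V ` {a<..a + 2 * int n}" "range E = E ` {a<..a + 2 * int n}"
proof -
  have "V i \<in> V ` {a<..a + 2 * int n}" "E i \<in> E ` {a<..a + 2 * int n}" for i
    by (metis window_surj[of a i] V_eq E_eq image_eqI)+
  then show "range V = V ` {a<..a + 2 * int n}" "range E = E ` {a<..a + 2 * int n}"
    by blast+
qed

lemma finite_verts: "finite (pverts G)"
  unfolding verts image_window[of 0] by simp

text \<open>Any \<open>2n\<close> consecutive indices enumerate each kind of vertex once. The two
  windows are independent because the window of inserted vertices symmetric about \<open>V 0\<close>
  is offset by one from the one used about \<open>E 0\<close>.\<close>

lemma sum_verts:
  fixes f :: "'a \<Rightarrow> nat"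
  shows "(\<Sum>x\<in>pverts G. f x) =
    (\<Sum>i\<in>{a<..a + 2 * int n}. f (V i)) + (\<Sum>i\<in>{b<..b + 2 * int n}. f (E i))"
proof -
  have "inj_on V {a<..a + 2 * int n}" "inj_on E {b<..b + 2 * int n}"
    using window_inj[of _ a] window_inj[of _ b] by (auto intro!: inj_onI simp: V_eq E_eq)
  moreover have "V ` {a<..a + 2 * int n} \<inter> E ` {b<..b + 2 * int n} = {}"
    using V_ne_E by blast
  ultimately show ?thesis
    unfolding verts image_window(1)[of a] image_window(2)[of b]
    by (simp add: sum.union_disjoint sum.reindex)
qed

lemma card_verts: "card (pverts G) = 4 * n"
  using sum_verts[of "\<lambda>_. 1" 0 0] by simp

section \<open>Strategies along weighted trees in the middle graph\<close>

lemma sum_window_power: "(\<Sum>i\<in>{- int n<..int n}. 2 ^ nat (int n - \<bar>i\<bar>)) + 3 = 3 * (2 :: nat) ^ n"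
proof (induction n)
  case (Suc n)
  \<comment> \<open>Enlarging \<open>n\<close> by one doubles every old weight and adds the weights
    \<open>1\<close> and \<open>2\<close> at the two new indices.\<close>
  have "{- int (Suc n)<..int (Suc n)} = insert (int (Suc n)) (insert (- int n) {- int n<..int n})"
    by auto
  moreover have "(\<Sum>i\<in>{- int n<..int n}. 2 ^ nat (int (Suc n) - \<bar>i\<bar>)) =
      2 * (\<Sum>i\<in>{- int n<..int n}. (2::nat) ^ nat (int n - \<bar>i\<bar>))"
    unfolding sum_distrib_left
  proof (rule sum.cong[OF refl])
    fix i assume "i \<in> {- int n<..int n}"
    then have "nat (int (Suc n) - \<bar>i\<bar>) = Suc (nat (int n - \<bar>i\<bar>))" by auto
    then show "2 ^ nat (int (Suc n) - \<bar>i\<bar>) = 2 * (2::nat) ^ nat (int n - \<bar>i\<bar>)" by simp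
  qed
  ultimately show ?case
    using Suc.IH by (cases "n = 0") auto
qed simp

lemma sum_window_leaves:
  "(\<Sum>i\<in>{- int n<..int n}. if i = int n \<or> i = 1 - int n then 1 else t) = 2 + t * (2 * n - 2)"
  for t :: nat
proof -
  let ?W = "{- int n<..int n}"
  have "?W = insert (int n) (insert (1 - int n) {1 - int n<..<int n})"
    using two_le by auto
  then have "(\<Sum>i\<in>?W. if i = int n \<or> i = 1 - int n then 1 else t) =
      2 + (\<Sum>i\<in>{1 - int n<..<int n}. if i = int n \<or> i = 1 - int n then 1 else t)"
    using two_le by simp
  also have "(\<Sum>i\<in>{1 - int n<..<int n}. if i = int n \<or> i = 1 - int n then 1 else t) =
      (\<Sum>i\<in>{1 - int n<..<int n}. t)"
    by (rule sum.cong) auto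
  also have "\<dots> = t * (2 * n - 2)"
    by (simp add: nat_diff_distrib' nat_mult_distrib)
  finally show ?thesis .
qed

text \<open>Weights double towards the root along inserted vertices, while original vertices are
  leaves with small weights to keep the loss small. The choice \<open>t = 1\<close> gives the least
  loss; \<open>t = 2\<close> gives weight at least \<open>2\<close> to all vertices except
  \<open>V n\<close>, \<open>V (1 - n)\<close> and \<open>E n\<close>, the ones at distance
  \<open>n\<close> from \<open>E 0\<close>.\<close>

lemma breadth_first_tree_at_E:
  assumes "0 < t" "t \<le> 2"
  shows "\<exists>q. reach G p q \<and>
    (\<Sum>i\<in>{- int n<..int n}. (if i = int n \<or> i = 1 - int n then 1 else t) * p (V i)) +
    (\<Sum>i\<in>{- int n<..int n}. 2 ^ nat (int n - \<bar>i\<bar>) * p (E i))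
      \<le> 2 ^ n * q (E 0) + (2 ^ (n + 1) + t * (2 * n - 2) - 1)"
proof -
  let ?W = "{- int n<..int n}"
  let ?X = "?W <+> ?W" and ?g = "case_sum V E"
  let ?w = "case_sum (\<lambda>i. if i = int n \<or> i = 1 - int n then 1 else t) (\<lambda>i. 2 ^ nat (int n - \<bar>i\<bar>))"
  \<comment> \<open>An original vertex hangs from the nearer of its two inserted neighbours; the
    antipodal \<open>E n\<close> hangs from \<open>E (n - 1)\<close>.\<close>
  let ?par = "case_sum (\<lambda>i. Inr (if 0 < i then i - 1 else i)) (\<lambda>i. Inr (i - sgn i))"
  have inj: "i = j" if "i \<in> ?W" "j \<in> ?W" "i mod (2 * int n) = j mod (2 * int n)" for i j
    using window_inj[of i "- int n" j] that by simp
  have "\<exists>q. reach G p q \<and>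
      (\<Sum>z\<in>?X. ?w z * p (?g z)) \<le> ?w (Inr 0) * q (?g (Inr 0)) + (\<Sum>z\<in>?X - {Inr 0}. ?w z)"
  proof (rule weight_function[where par = ?par])
    show "inj_on ?g ?X"
      using V_ne_E V_ne_E[symmetric]
      by (intro inj_onI) (auto simp: V_eq E_eq intro: inj)
    fix z assume z: "z \<in> ?X"
    then show "0 < ?w z" using assms by auto
    assume "z \<noteq> Inr 0"
    show "?par z \<in> ?X \<and> (?g z, ?g (?par z)) \<in> parcs G \<and> 2 * ?w z \<le> ?w (?par z)"
    proof (cases z)
      case (Inl i)
      have i: "i \<in> ?W" using z Inl by auto
      \<comment> \<open>The two leaves of weight \<open>1\<close> hang from weight \<open>2\<close>,
        all others from weight at least \<open>4\<close>, which permits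
        \<open>t = 2\<close>.\<close>
      have "2 * (if i = int n \<or> i = 1 - int n then 1 else t) \<le>
          2 ^ nat (int n - \<bar>if 0 < i then i - 1 else i\<bar>)"
      proof (cases "i = int n \<or> i = 1 - int n")
        case True
        then have "nat (int n - \<bar>if 0 < i then i - 1 else i\<bar>) = 1"
          using two_le by auto
        then show ?thesis using True by simp
      next
        case False
        then have "2 \<le> nat (int n - \<bar>if 0 < i then i - 1 else i\<bar>)"
          using i by auto
        then have "(2::nat) ^ 2 \<le> 2 ^ nat (int n - \<bar>if 0 < i then i - 1 else i\<bar>)"
          by (rule power_increasing) simp
        then show ?thesis using False assms(2) by simp
      qed
      then show ?thesis
        using Inl i arc_VE(1)[of i] arc_VE(3)[of "i - 1"] by auto
    next
      case (Inr i)
      have i: "i \<in> ?W" "i \<noteq> 0" using z Inr \<open>z \<noteq> Inr 0\<close> by auto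
      then have "nat (int n - \<bar>i - sgn i\<bar>) = Suc (nat (int n - \<bar>i\<bar>))"
        by (auto simp: sgn_if abs_if)
      then show ?thesis
        using Inr i arc_EE(1)[of i] arc_EE(2)[of "i - 1"] by (auto simp: sgn_if)
    qed
  qed (use two_le in auto)
  then obtain q where q: "reach G p q"
    "(\<Sum>z\<in>?X. ?w z * p (?g z)) \<le> 2 ^ n * q (E 0) + (\<Sum>z\<in>?X - {Inr 0}. ?w z)"
    by auto
  have "(\<Sum>z\<in>?X. ?w z) = 2 ^ n + (\<Sum>z\<in>?X - {Inr 0}. ?w z)"
    using sum.remove[of ?X "Inr 0" ?w] two_le InrI[of 0 ?W ?W] by auto
  moreover have "(\<Sum>z\<in>?X. ?w z) = 2 + t * (2 * n - 2) + (\<Sum>i\<in>?W. 2 ^ nat (int n - \<bar>i\<bar>))"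
    by (simp add: sum.Plus sum_window_leaves)
  ultimately have "(\<Sum>z\<in>?X - {Inr 0}. ?w z) = 2 ^ (n + 1) + t * (2 * n - 2) - 1"
    using sum_window_power by simp
  with q show ?thesis
    by (auto simp: sum.Plus)
qed

lemma sum_descending_powers: "(\<Sum>i<k. 2 ^ (k - i)) + 2 = (2 :: nat) ^ (k + 1)"
proof (induction k)
  case (Suc k)
  have "(\<Sum>i<Suc k. 2 ^ (Suc k - i)) = (2::nat) ^ Suc k + (\<Sum>i<k. 2 ^ (k - i))"
    by (simp add: sum.lessThan_Suc_shift del: sum.lessThan_Suc)
  then show ?case using Suc by simp
qed simp

text \<open>On the path from \<open>E n\<close> down to \<open>E 0\<close>, \<open>V n\<close>
  enters at \<open>E (n - 1)\<close> but \<open>V (n + 1)\<close> only at \<open>E n\<close>, hence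
  its halved weight. Added to its mirror image, the inequality gives each of the three farthest
  vertices weight at least \<open>3\<close>.\<close>

lemma path_to_far_side_at_E:
  "\<exists>q. reach G p q \<and> 2 * p (V (int n)) + 2 * p (E (int n)) + p (V (int n + 1))
      \<le> 2 ^ (n + 1) * q (E 0) + (2 ^ (n + 1) + 1)"
proof -
  let ?X = "{n, n + 1} <+> {..<n + 1}" and ?g = "case_sum (\<lambda>i. V (int i)) (\<lambda>i. E (int i))"
  let ?w = "case_sum (\<lambda>i. if i = n then 2 else 1) (\<lambda>i. 2 ^ (n + 1 - i)) :: nat + nat \<Rightarrow> nat"
  let ?par = "case_sum (\<lambda>i. Inr (i - 1)) (\<lambda>i. Inr (i - 1)) :: nat + nat \<Rightarrow> nat + nat"
  have "\<exists>q. reach G p q \<and>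
      (\<Sum>z\<in>?X. ?w z * p (?g z)) \<le> ?w (Inr 0) * q (?g (Inr 0)) + (\<Sum>z\<in>?X - {Inr 0}. ?w z)"
  proof (rule weight_function[where par = ?par])
    have "V (int n) \<noteq> V (1 + int n)"
      using window_inj[of "int n" "int n - 1" "1 + int n"] two_le by (auto simp: V_eq)
    moreover have "E (int i) = E (int j) \<longleftrightarrow> i = j" if "i < n + 1" "j < n + 1" for i j
      using window_inj[of "int i" "- 1" "int j"] that two_le by (auto simp: E_eq)
    ultimately show "inj_on ?g ?X"
      using V_ne_E V_ne_E[symmetric] by (intro inj_onI) (auto dest: sym)
    fix z assume z: "z \<in> ?X"
    then show "0 < ?w z" by auto
    assume "z \<noteq> Inr 0"
    show "?par z \<in> ?X \<and> (?g z, ?g (?par z)) \<in> parcs G \<and> 2 * ?w z \<le> ?w (?par z)"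
    proof (cases z)
      case (Inl i)
      have i: "i = n \<or> i = n + 1" using z Inl by auto
      have "(V (int i), E (int (i - 1))) \<in> parcs G"
        using arc_VE(3)[of "int i - 1"] i two_le by (auto simp: of_nat_diff)
      then show ?thesis using Inl i two_le by auto
    next
      case (Inr i)
      have i: "i < n + 1" "i \<noteq> 0" using z Inr \<open>z \<noteq> Inr 0\<close> by auto
      have "(E (int i), E (int (i - 1))) \<in> parcs G"
        using arc_EE(2)[of "int i - 1"] i by (simp add: of_nat_diff)
      moreover have "n + 1 - (i - 1) = Suc (n + 1 - i)" using i by simp
      ultimately show ?thesis using Inr i by auto
    qed
  qed auto
  then obtain q where q: "reach G p q"
    "(\<Sum>z\<in>?X. ?w z * p (?g z)) \<le> 2 ^ (n + 1) * q (E 0) + (\<Sum>z\<in>?X - {Inr 0}. ?w z)"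
    by auto
  have "(\<Sum>z\<in>?X. ?w z) = 2 ^ (n + 1) + (\<Sum>z\<in>?X - {Inr 0}. ?w z)"
    using sum.remove[of ?X "Inr 0" ?w] InrI[of 0 "{..<n + 1}"] by auto
  moreover have "(\<Sum>z\<in>?X. ?w z) + 2 = 2 ^ (n + 2) + 3"
    using sum_descending_powers[of "n + 1"] by (simp add: sum.Plus)
  ultimately have "(\<Sum>z\<in>?X - {Inr 0}. ?w z) = 2 ^ (n + 1) + 1"
    by simp
  moreover have "2 * p (V (int n)) + 2 * p (E (int n)) + p (V (int n + 1)) \<le> (\<Sum>z\<in>?X. ?w z * p (?g z))"
    by (simp add: sum.Plus add.commute)
  ultimately show ?thesis
    using q by (intro exI[of _ q]) linarith
qed

text \<open>The path runs through \<open>E 0\<close>, ..., \<open>E (n - 1)\<close> to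
  \<open>V n\<close>, with the original vertices in between as leaves of weight \<open>2\<close>.
  The opposite vertex gets only weight \<open>1\<close>, but it is counted again in the other half
  of the cycle.\<close>

lemma path_to_opposite_vertex_at_V:
  "\<exists>q. reach G p q \<and> p (V (int n)) + 2 * (\<Sum>i<n. p (V (int i)) + p (E (int i)))
      \<le> 2 ^ (n + 1) * q (V 0) + (2 ^ (n + 1) + 2 * n - 3)"
proof -
  let ?X = "{..n} <+> {..<n}" and ?g = "case_sum (\<lambda>i. V (int i)) (\<lambda>i. E (int i))"
  let ?w = "case_sum (\<lambda>i. if i = 0 then 2 ^ (n + 1) else if i = n then 1 else 2) (\<lambda>i. 2 ^ (n - i)) :: nat + nat \<Rightarrow> nat"
  let ?par = "case_sum (\<lambda>i. Inr (i - 1)) (\<lambda>i. if i = 0 then Inl 0 else Inr (i - 1)) :: nat + nat \<Rightarrow> nat + nat"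
  have "\<exists>q. reach G p q \<and>
      (\<Sum>z\<in>?X. ?w z * p (?g z)) \<le> ?w (Inl 0) * q (?g (Inl 0)) + (\<Sum>z\<in>?X - {Inl 0}. ?w z)"
  proof (rule weight_function[where par = ?par])
    have "V (int i) = V (int j) \<longleftrightarrow> i = j" "E (int i) = E (int j) \<longleftrightarrow> i = j" if "i \<le> n" "j \<le> n" for i j
      using window_inj[of "int i" "- 1" "int j"] that two_le by (auto simp: V_eq E_eq)
    then show "inj_on ?g ?X"
      using V_ne_E V_ne_E[symmetric] by (intro inj_onI) auto
    fix z assume z: "z \<in> ?X"
    then show "0 < ?w z" by auto
    assume "z \<noteq> Inl 0"
    show "?par z \<in> ?X \<and> (?g z, ?g (?par z)) \<in> parcs G \<and> 2 * ?w z \<le> ?w (?par z)"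
    proof (cases z)
      case (Inl i)
      have i: "i \<le> n" "i \<noteq> 0" using z Inl \<open>z \<noteq> Inl 0\<close> by auto
      have "(V (int i), E (int (i - 1))) \<in> parcs G"
        using arc_VE(3)[of "int i - 1"] i by (simp add: of_nat_diff)
      moreover have "2 * (if i = n then 1 else 2) \<le> (2 :: nat) ^ (n - (i - 1))"
      proof (cases "i = n")
        case False
        then have "(2 :: nat) ^ 2 \<le> 2 ^ (n - (i - 1))"
          using i by (intro power_increasing) auto
        then show ?thesis using False by simp
      qed (use i in simp)
      ultimately show ?thesis using Inl i by auto
    next
      case (Inr i)
      have i: "i < n" using z Inr by auto
      have "(E (int i), E (int (i - 1))) \<in> parcs G" "n - (i - 1) = Suc (n - i)" if "i \<noteq> 0"
        using arc_EE(2)[of "int i - 1"] i that by (simp_all add: of_nat_diff)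
      then show ?thesis using Inr i arc_VE(2)[of 0] by auto
    qed
  qed auto
  then obtain q where q: "reach G p q"
    "(\<Sum>z\<in>?X. ?w z * p (?g z)) \<le> 2 ^ (n + 1) * q (V 0) + (\<Sum>z\<in>?X - {Inl 0}. ?w z)"
    by auto
  have split: "{..n} = insert 0 (insert n {0<..<n})" "{..<n} = insert 0 {0<..<n}"
    using two_le by auto
  have inner: "(\<Sum>i\<in>{0<..<n}. (if i = 0 then a else if i = n then b else c) * f i) = (\<Sum>i\<in>{0<..<n}. c * f i)"
    for a b c :: nat and f
    by (rule sum.cong) auto
  have "(\<Sum>z\<in>?X. ?w z) = 2 ^ (n + 1) + (\<Sum>z\<in>?X - {Inl 0}. ?w z)"
    using sum.remove[of ?X "Inl 0" ?w] InlI[of 0 "{..n}" "{..<n}"] by auto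
  moreover have "(\<Sum>z\<in>?X. ?w z) + 2 = 2 ^ (n + 1) + 1 + 2 * (n - 1) + 2 ^ (n + 1)"
    using sum_descending_powers[of n] inner[of _ _ _ "\<lambda>_. 1"] two_le
    by (simp add: sum.Plus split(1))
  ultimately have "(\<Sum>z\<in>?X - {Inl 0}. ?w z) = 2 ^ (n + 1) + 2 * n - 3"
    using two_le by simp
  moreover have "p (V (int n)) + 2 * (\<Sum>i<n. p (V (int i)) + p (E (int i))) \<le> (\<Sum>z\<in>?X. ?w z * p (?g z))"
  proof -
    have "2 * p (V 0) \<le> 2 ^ (n + 1) * p (V 0)"
      by simp
    then have "p (V (int n)) + 2 * (\<Sum>i<n. p (V (int i))) \<le>
        (\<Sum>i\<le>n. (if i = 0 then 2 ^ (n + 1) else if i = n then 1 else 2) * p (V (int i)))"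
      using two_le by (simp add: split inner sum_distrib_left)
    moreover have "2 * (\<Sum>i<n. p (E (int i))) \<le> (\<Sum>i<n. 2 ^ (n - i) * p (E (int i)))"
      unfolding sum_distrib_left
    proof (rule sum_mono)
      fix i assume "i \<in> {..<n}"
      then have "(2 :: nat) ^ 1 \<le> 2 ^ (n - i)"
        by (intro power_increasing) auto
      then show "2 * p (E (int i)) \<le> 2 ^ (n - i) * p (E (int i))" by simp
    qed
    ultimately show ?thesis
      by (simp add: sum.Plus sum.distrib)
  qed
  ultimately show ?thesis
    using q by (intro exI[of _ q]) linarith
qed

section \<open>Delivering a prescribed number of pebbles\<close>

lemma V_period: "V (i + 2 * int n) = V i" and E_period: "E (i + 2 * int n) = E i"
  by (simp_all add: V_eq E_eq)

text \<open>The tree with \<open>t = 1\<close> counts every pebble at least once and costs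
  \<open>2 ^ n\<close> per delivered pebble. For \<open>c \<ge> 1\<close> the doubled rate in the
  assumption absorbs its loss \<open>2 ^ (n + 1) + 2 * n - 3\<close>, and it is the rate that
  original vertices require.\<close>

lemma many_pebbles_at_E:
  assumes "2 ^ (n + 1) * c + (2 * n - 2) \<le> (\<Sum>x\<in>pverts G. p x)"
  shows "\<exists>q. reach G p q \<and> c \<le> q (E 0)"
proof -
  let ?W = "{- int n<..int n}"
  obtain q where q: "reach G p q"
    "(\<Sum>i\<in>?W. (if i = int n \<or> i = 1 - int n then 1 else 1) * p (V i)) +
     (\<Sum>i\<in>?W. 2 ^ nat (int n - \<bar>i\<bar>) * p (E i))
       \<le> 2 ^ n * q (E 0) + (2 ^ (n + 1) + 1 * (2 * n - 2) - 1)"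
    using breadth_first_tree_at_E[of 1 p] by auto
  have "(\<Sum>i\<in>?W. p (E i)) \<le> (\<Sum>i\<in>?W. 2 ^ nat (int n - \<bar>i\<bar>) * p (E i))"
    by (rule sum_mono) simp
  then have "(\<Sum>x\<in>pverts G. p x) \<le> 2 ^ n * q (E 0) + (2 ^ (n + 1) + (2 * n - 2) - 1)"
    using q(2) sum_verts[of p "- int n" "- int n"] by simp
  then have 1: "2 ^ (n + 1) * c + 1 \<le> 2 ^ n * q (E 0) + 2 ^ (n + 1)"
    using assms one_le_power[of "2 :: nat" "n + 1"] by linarith
  have "c \<le> q (E 0)"
  proof (rule ccontr)
    assume "\<not> c \<le> q (E 0)"
    then have "q (E 0) + 1 \<le> c" "1 \<le> c"
      by simp_all
    from this[THEN mult_le_mono2, of "2 ^ n"]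
    have "2 ^ n * (q (E 0) + 1) \<le> 2 ^ n * c" "2 ^ n \<le> 2 ^ n * c"
      by simp_all
    with 1 show False by (simp add: algebra_simps)
  qed
  with q(1) show ?thesis by blast
qed

text \<open>Each half of the cycle gives a strategy. In the sum of both inequalities every pebble
  weighs at least \<open>2\<close>: \<open>V n\<close> lies in both halves with weight
  \<open>1\<close>, every other vertex has weight \<open>2\<close> in some half. Hence the better of
  the two strategies delivers \<open>c\<close>.\<close>

lemma many_pebbles_at_V:
  assumes "2 ^ (n + 1) * c + (2 * n - 2) \<le> (\<Sum>x\<in>pverts G. p x)"
  shows "\<exists>q. reach G p q \<and> c \<le> q (V 0)"
proof -
  interpret R: sun G n "\<lambda>i. V (0 - i)" "\<lambda>i. E (0 - 1 - i)"
    by (rule sun_reflect)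
  obtain q1 where q1: "reach G p q1" "p (V (int n)) + 2 * (\<Sum>i<n. p (V (int i)) + p (E (int i)))
      \<le> 2 ^ (n + 1) * q1 (V 0) + (2 ^ (n + 1) + 2 * n - 3)"
    using path_to_opposite_vertex_at_V by blast
  obtain q2 where q2: "reach G p q2"
    "p (V (- int n)) + 2 * (\<Sum>i<n. p (V (- int i)) + p (E (- 1 - int i)))
      \<le> 2 ^ (n + 1) * q2 (V 0) + (2 ^ (n + 1) + 2 * n - 3)"
    using R.path_to_opposite_vertex_at_V[of p] by auto
  have opposite: "V (- int n) = V (int n)"
    using V_period[of "- int n"] by simp
  have union_le: "sum f (A \<union> B) \<le> sum f A + sum f B" if "finite A" "finite B" for f :: "int \<Rightarrow> nat" and A B
    using sum.union_inter[OF that, of f] by linarith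
  \<comment> \<open>Both halves contain \<open>V 0\<close>, so they cover the window without
    partitioning it; counting \<open>V 0\<close> twice is harmless in an upper bound.\<close>
  have "{- int n<..- int n + 2 * int n} \<subseteq> insert (int n) (int ` {..<n} \<union> (\<lambda>i. - int i) ` {..<n})"
  proof
    fix i assume "i \<in> {- int n<..- int n + 2 * int n}"
    then show "i \<in> insert (int n) (int ` {..<n} \<union> (\<lambda>i. - int i) ` {..<n})"
      by (cases i rule: int_cases2) auto
  qed
  then have "(\<Sum>i\<in>{- int n<..- int n + 2 * int n}. p (V i)) \<le>
      (\<Sum>i\<in>insert (int n) (int ` {..<n} \<union> (\<lambda>i. - int i) ` {..<n}). p (V i))"
    by (intro sum_mono2) auto
  also have "\<dots> \<le> p (V (int n)) + ((\<Sum>i<n. p (V (int i))) + (\<Sum>i<n. p (V (- int i))))"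
    using union_le[of "{int n}" "int ` {..<n} \<union> (\<lambda>i. - int i) ` {..<n}" "\<lambda>i. p (V i)"]
      union_le[of "int ` {..<n}" "(\<lambda>i. - int i) ` {..<n}" "\<lambda>i. p (V i)"]
    by (simp add: sum.reindex inj_on_def)
  finally have sV: "(\<Sum>i\<in>{- int n<..- int n + 2 * int n}. p (V i)) \<le> \<dots>" .
  have "{- 1 - int n<..- 1 - int n + 2 * int n} \<subseteq> int ` {..<n} \<union> (\<lambda>i. - 1 - int i) ` {..<n}"
  proof
    fix i assume i: "i \<in> {- 1 - int n<..- 1 - int n + 2 * int n}"
    show "i \<in> int ` {..<n} \<union> (\<lambda>i. - 1 - int i) ` {..<n}"
    proof (cases "0 \<le> i")
      case True
      then show ?thesis using i by (auto intro!: image_eqI[of _ _ "nat i"])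
    next
      case False
      then show ?thesis using i by (auto intro!: image_eqI[of _ _ "nat (- 1 - i)"])
    qed
  qed
  then have "(\<Sum>i\<in>{- 1 - int n<..- 1 - int n + 2 * int n}. p (E i)) \<le>
      (\<Sum>i\<in>int ` {..<n} \<union> (\<lambda>i. - 1 - int i) ` {..<n}. p (E i))"
    by (intro sum_mono2) auto
  also have "\<dots> \<le> (\<Sum>i<n. p (E (int i))) + (\<Sum>i<n. p (E (- 1 - int i)))"
    using union_le[of "int ` {..<n}" "(\<lambda>i. - 1 - int i) ` {..<n}" "\<lambda>i. p (E i)"]
    by (simp add: sum.reindex inj_on_def)
  finally have sE: "(\<Sum>i\<in>{- 1 - int n<..- 1 - int n + 2 * int n}. p (E i)) \<le> \<dots>" .
  have "2 * (\<Sum>x\<in>pverts G. p x) \<le>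
      2 ^ (n + 1) * q1 (V 0) + 2 ^ (n + 1) * q2 (V 0) + 2 * (2 ^ (n + 1) + 2 * n - 3)"
    using q1(2) q2(2) sV sE sum_verts[of p "- int n" "- 1 - int n"] opposite
    by (simp add: sum.distrib)
  moreover have "3 \<le> 2 ^ (n + 1) + 2 * n"
    using two_le by linarith
  ultimately have 1: "2 * (2 ^ (n + 1) * c) + 2 \<le>
      2 ^ (n + 1) * q1 (V 0) + 2 ^ (n + 1) * q2 (V 0) + 2 * 2 ^ (n + 1)"
    using assms two_le by linarith
  have "c \<le> q1 (V 0) \<or> c \<le> q2 (V 0)"
  proof (rule ccontr)
    assume "\<not> ?thesis"
    then have "q1 (V 0) + 1 \<le> c" "q2 (V 0) + 1 \<le> c"
      by simp_all
    from this[THEN mult_le_mono2, of "2 ^ (n + 1)"]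
    have "2 ^ (n + 1) * (q1 (V 0) + 1) \<le> 2 ^ (n + 1) * c"
      "2 ^ (n + 1) * (q2 (V 0) + 1) \<le> 2 ^ (n + 1) * c"
      by simp_all
    with 1 show False unfolding distrib_left by linarith
  qed
  with q1(1) q2(1) show ?thesis by blast
qed

text \<open>A shift moves any vertex to index \<open>0\<close>. The case \<open>c = 1\<close> bounds
  the pebbling number from above; larger \<open>c\<close> serves the fibers of the product.\<close>

lemma many_pebbles:
  assumes "s \<in> pverts G" "2 ^ (n + 1) * c + (2 * n - 2) \<le> (\<Sum>x\<in>pverts G. p x)"
  shows "\<exists>q. reach G p q \<and> c \<le> q s"
proof -
  obtain i where "s = V i \<or> s = E i"
    using assms(1) verts by auto
  then show ?thesis
    using sun.many_pebbles_at_V[OF sun_shift[of i] assms(2)]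
      sun.many_pebbles_at_E[OF sun_shift[of i] assms(2)] by auto
qed

end

text \<open>
  Two inequalities for an unsolvable configuration are averaged. Emptying every row along a breadth
  first tree of \<open>G\<close> into the fiber over \<open>E 0\<close> bounds the pebbles with weight at least \<open>2\<close>,
  except that the three fibers farthest from \<open>E 0\<close> only get weight \<open>1\<close>. These three fibers are
  bounded once more by first emptying them into the row of \<open>s\<close>.
\<close>

lemma (in sun) unsolvable_product_bound:
  fixes H :: "'b pair_pre_digraph" and K L :: nat
  assumes H: "finite (pverts H)" and s: "s \<in> pverts H" and K: "0 < K"
    and many: "\<And>p c. K * c + L \<le> (\<Sum>y\<in>pverts H. p y) \<Longrightarrow> \<exists>q. reach H p q \<and> c \<le> q s"
    and unsolvable: "\<not> can_reach (cart_prod G H) P (E 0, s)"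
  shows "6 * (\<Sum>z\<in>pverts (cart_prod G H). P z) \<le>
    3 * (2 ^ n * (K + L - 1)) + 3 * (card (pverts H) * (2 ^ (n + 1) + 2 * (2 * n - 2) - 1)) +
    K * (2 ^ (n + 2) + 2) + 9 * (K + L - 1)"
proof -
  let ?W = "{- int n<..int n}"
  let ?a = "\<lambda>i. if i = int n \<or> i = 1 - int n then 1 else 2 :: nat"
  let ?S = "2 ^ (n + 1) + 2 * (2 * n - 2) - 1 :: nat"
  define f where "f x = (\<Sum>y\<in>pverts H. P (x, y))" for x
  have inG: "V i \<in> pverts G" "E i \<in> pverts G" for i
    using verts by auto

  have rows: "(\<Sum>i\<in>?W. ?a i * f (V i)) + (\<Sum>i\<in>?W. 2 ^ nat (int n - \<bar>i\<bar>) * f (E i))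
      \<le> 2 ^ n * (K + L - 1) + card (pverts H) * ?S"
  proof -
    have "\<forall>y. \<exists>q. reach G (\<lambda>x. P (x, y)) q \<and>
        (\<Sum>i\<in>?W. ?a i * P (V i, y)) + (\<Sum>i\<in>?W. 2 ^ nat (int n - \<bar>i\<bar>) * P (E i, y))
          \<le> 2 ^ n * q (E 0) + ?S"
      by (intro allI, rule breadth_first_tree_at_E) simp_all
    from choice[OF this] obtain q where q: "\<And>y. reach G (\<lambda>x. P (x, y)) (q y)"
      "\<And>y. (\<Sum>i\<in>?W. ?a i * P (V i, y)) + (\<Sum>i\<in>?W. 2 ^ nat (int n - \<bar>i\<bar>) * P (E i, y))
          \<le> 2 ^ n * q y (E 0) + ?S"
      by blast
    let ?Q = "\<lambda>(x, y). if y \<in> pverts H then q y x else P (x, y)"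
    have PQ: "reach (cart_prod G H) P ?Q"
      by (rule reach_rows) (use H q(1) in auto)
    \<comment> \<open>With \<open>K + L\<close> pebbles in the fiber over \<open>E 0\<close>,
      \<open>many\<close> for \<open>c = 1\<close> would bring one to \<open>s\<close>.\<close>
    have "(\<Sum>y\<in>pverts H. q y (E 0)) \<le> K + L - 1"
    proof (rule ccontr)
      assume "\<not> ?thesis"
      then have "K * 1 + L \<le> (\<Sum>y\<in>pverts H. ?Q (E 0, y))"
        by simp
      from many[OF this] obtain q' where q': "reach H (\<lambda>y. ?Q (E 0, y)) q'" "1 \<le> q' s"
        by blast
      have "reach (cart_prod G H) ?Q (\<lambda>(x, y). if x \<in> {E 0} then q' y else ?Q (x, y))"
        by (rule reach_columns) (use inG q'(1) in auto)
      then have "can_reach (cart_prod G H) ?Q (E 0, s)"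
        by (rule can_reachI) (use q'(2) in simp)
      from can_reach_if_reach[OF PQ this] unsolvable show False
        by contradiction
    qed
    then have le: "2 ^ n * (\<Sum>y\<in>pverts H. q y (E 0)) \<le> 2 ^ n * (K + L - 1)"
      by (rule mult_left_mono) simp
    have "(\<Sum>y\<in>pverts H. (\<Sum>i\<in>?W. ?a i * P (V i, y)) + (\<Sum>i\<in>?W. 2 ^ nat (int n - \<bar>i\<bar>) * P (E i, y)))
        \<le> (\<Sum>y\<in>pverts H. 2 ^ n * q y (E 0) + ?S)"
      by (rule sum_mono) (rule q(2))
    moreover have "(\<Sum>y\<in>pverts H. (\<Sum>i\<in>?W. c i * P (g i, y))) = (\<Sum>i\<in>?W. c i * f (g i))" for c g
      unfolding f_def sum_distrib_left by (rule sum.swap)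
    ultimately have "(\<Sum>i\<in>?W. ?a i * f (V i)) + (\<Sum>i\<in>?W. 2 ^ nat (int n - \<bar>i\<bar>) * f (E i))
        \<le> 2 ^ n * (\<Sum>y\<in>pverts H. q y (E 0)) + card (pverts H) * ?S"
      by (simp add: sum.distrib sum_distrib_left[symmetric])
    with le show ?thesis by linarith
  qed

  have far: "3 * (f (V (int n)) + f (V (1 - int n)) + f (E (int n))) \<le>
      K * (2 ^ (n + 2) + 2) + 9 * (K + L - 1)"
  proof -
    let ?c = "\<lambda>x. (f x - L) div K"
    have "\<exists>q. reach H (\<lambda>y. P (x, y)) q \<and> ?c x \<le> q s" for x
    proof (cases "L \<le> f x")
      case True
      then have "K * ?c x + L \<le> (\<Sum>y\<in>pverts H. P (x, y))"
        using times_div_less_eq_dividend[of K "f x - L"] f_def[of x] by linarith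
      then show ?thesis by (rule many)
    qed auto
    then obtain q where q: "\<And>x. reach H (\<lambda>y. P (x, y)) (q x)" "\<And>x. ?c x \<le> q x s"
      by metis
    let ?Q = "\<lambda>(x, y). if x \<in> pverts G then q x y else P (x, y)"
    have PQ: "reach (cart_prod G H) P ?Q"
      by (rule reach_columns) (use finite_verts q(1) in auto)
    have no_pebble: "q' (E 0) = 0" if "reach G (\<lambda>x. if x \<in> pverts G then q x s else P (x, s)) q'" for q'
    proof (rule ccontr)
      assume "q' (E 0) \<noteq> 0"
      have "reach (cart_prod G H) ?Q (\<lambda>(x, y). if y = s then q' x else ?Q (x, y))"
        by (rule reach_row[OF s]) (use that in simp)
      then have "can_reach (cart_prod G H) ?Q (E 0, s)"
        by (rule can_reachI) (use \<open>q' (E 0) \<noteq> 0\<close> in simp)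
      from can_reach_if_reach[OF PQ this] unsolvable show False
        by contradiction
    qed
    interpret R: sun G n "\<lambda>i. V (1 - i)" "\<lambda>i. E (1 - 1 - i)"
      by (rule sun_reflect)
    have mirror: "V (int n + 1) = V (1 - int n)" "V (- int n) = V (int n)" "E (- int n) = E (int n)"
      using V_period[of "1 - int n"] V_period[of "- int n"] E_period[of "- int n"]
      by (simp_all add: add.commute)
    \<comment> \<open>No pebble can arrive at \<open>E 0\<close> within the row of \<open>s\<close>,
      so only the loss remains on the right. The reflected path swaps the two far original
      vertices.\<close>
    have "2 * q (V (int n)) s + 2 * q (E (int n)) s + q (V (1 - int n)) s \<le> 2 ^ (n + 1) + 1"
      using path_to_far_side_at_E[of "\<lambda>x. ?Q (x, s)"] inG mirror by (auto dest: no_pebble)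
    moreover have "2 * q (V (1 - int n)) s + 2 * q (E (int n)) s + q (V (int n)) s \<le> 2 ^ (n + 1) + 1"
      using R.path_to_far_side_at_E[of "\<lambda>x. ?Q (x, s)"] inG mirror by (auto dest: no_pebble)
    ultimately have "3 * (?c (V (int n)) + ?c (V (1 - int n)) + ?c (E (int n))) \<le> 2 ^ (n + 2) + 2"
      using q(2)[of "V (int n)"] q(2)[of "V (1 - int n)"] q(2)[of "E (int n)"] by simp
    then have "K * (3 * (?c (V (int n)) + ?c (V (1 - int n)) + ?c (E (int n)))) \<le> K * (2 ^ (n + 2) + 2)"
      by (rule mult_left_mono) simp
    moreover have fiber: "f x \<le> K * ?c x + (K + L - 1)" for x
    proof -
      have "f x - L < K * ?c x + K"
        using dividend_less_times_div[OF K, of "f x - L"] by simp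
      then show ?thesis by linarith
    qed
    have triple: "3 * (a1 + a2 + a3) \<le> 3 * (b1 + b2 + b3) + 9 * k"
      if "a1 \<le> b1 + k" "a2 \<le> b2 + k" "a3 \<le> b3 + k" for a1 a2 a3 b1 b2 b3 k :: nat
      using that by simp
    have "3 * (f (V (int n)) + f (V (1 - int n)) + f (E (int n))) \<le>
        K * (3 * (?c (V (int n)) + ?c (V (1 - int n)) + ?c (E (int n)))) + 9 * (K + L - 1)"
      unfolding mult.left_commute[of K 3] distrib_left[of K] by (intro triple fiber)
    ultimately show ?thesis by linarith
  qed

  \<comment> \<open>Relative to weight \<open>2\<close> everywhere, the row inequality lacks at most
    one copy of each of the three far fibers.\<close>
  have "(\<Sum>i\<in>?W. 2 * f (V i)) = (\<Sum>i\<in>?W. ?a i * f (V i) + (if i = int n then f (V i) else 0) +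
      (if i = 1 - int n then f (V i) else 0))"
    by (rule sum.cong) (use two_le in auto)
  then have sV: "2 * (\<Sum>i\<in>?W. f (V i)) = (\<Sum>i\<in>?W. ?a i * f (V i)) + f (V (int n)) + f (V (1 - int n))"
    using two_le by (simp add: sum.distrib sum_distrib_left)
  have "(\<Sum>i\<in>?W. 2 * f (E i)) \<le>
      (\<Sum>i\<in>?W. 2 ^ nat (int n - \<bar>i\<bar>) * f (E i) + (if i = int n then f (E i) else 0))"
  proof (rule sum_mono)
    fix i assume "i \<in> ?W"
    show "2 * f (E i) \<le> 2 ^ nat (int n - \<bar>i\<bar>) * f (E i) + (if i = int n then f (E i) else 0)"
    proof (cases "i = int n")
      case False
      then have "(2 :: nat) ^ 1 \<le> 2 ^ nat (int n - \<bar>i\<bar>)"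
        using \<open>i \<in> ?W\<close> by (intro power_increasing) auto
      then show ?thesis by (simp add: trans_le_add1)
    qed simp
  qed
  then have sE: "2 * (\<Sum>i\<in>?W. f (E i)) \<le> (\<Sum>i\<in>?W. 2 ^ nat (int n - \<bar>i\<bar>) * f (E i)) + f (E (int n))"
    using two_le by (simp add: sum.distrib sum_distrib_left)
  have "(\<Sum>z\<in>pverts (cart_prod G H). P z) = (\<Sum>x\<in>pverts G. f x)"
    by (simp add: cart_prod_def f_def sum.cartesian_product)
  also have "\<dots> = (\<Sum>i\<in>?W. f (V i)) + (\<Sum>i\<in>?W. f (E i))"
    using sum_verts[of f "- int n" "- int n"] by simp
  finally have total: "(\<Sum>z\<in>pverts (cart_prod G H). P z) = (\<Sum>i\<in>?W. f (V i)) + (\<Sum>i\<in>?W. f (E i))" .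
  \<comment> \<open>Three times the row inequality plus \<open>far\<close>, which already carries
    the factor \<open>3\<close>.\<close>
  have combine: "6 * T \<le> 3 * r1 + 3 * r2 + r3 + r4"
    if "T = a + b" "A + B \<le> r1 + r2" "3 * (x + y + z) \<le> r3 + r4" "2 * a = A + x + y" "2 * b \<le> B + z"
    for T a b A B x y z r1 r2 r3 r4 :: nat
    using that by simp
  show ?thesis
    by (rule combine[OF total rows far sV sE])
qed

section \<open>The lower bound for the middle graph of an even cycle\<close>

text \<open>A distribution has exactly \<open>N\<close> pebbles, so monotonicity in \<open>N\<close>
  needs an argument: set one pebble aside and ignore it.\<close>

lemma can_reach_Suc:
  assumes "finite (pverts G)" "\<And>p. distribution G N p \<Longrightarrow> can_reach G p v" "distribution G (Suc N) p"
  shows "can_reach G p v"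
proof -
  have sum: "(\<Sum>x\<in>pverts G. p x) = Suc N" and supp: "\<And>x. x \<notin> pverts G \<Longrightarrow> p x = 0"
    using assms(3) by (auto simp: distribution_def)
  have "\<exists>x\<in>pverts G. p x \<noteq> 0"
    using sum by (metis sum.neutral nat.distinct(1))
  then obtain x where x: "x \<in> pverts G" "0 < p x" by auto
  let ?p = "p(x := p x - 1)"
  have "(\<Sum>z\<in>pverts G - {x}. ?p z) = (\<Sum>z\<in>pverts G - {x}. p z)"
    by (rule sum.cong) auto
  then have "(\<Sum>z\<in>pverts G. ?p z) = N"
    using sum x(2) sum.remove[OF assms(1) x(1), of p] sum.remove[OF assms(1) x(1), of ?p]
    by simp
  then have "distribution G N ?p"
    using supp by (auto simp: distribution_def)
  then have "can_reach G ?p v" by (rule assms(2))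
  then show ?thesis by (rule can_reach_mono) simp
qed

lemma can_reach_more:
  assumes "finite (pverts G)" "\<And>p. distribution G N p \<Longrightarrow> can_reach G p v" "N \<le> N'" "distribution G N' p"
  shows "can_reach G p v"
  using assms(3,4)
proof (induction arbitrary: p rule: dec_induct)
  case (step k)
  then show ?case using can_reach_Suc[OF assms(1)] by blast
qed (rule assms(2))

text \<open>A move changes only two summands. The potential of a vertex may be nonlinear in its
  pebbles, so that it can count pairs.\<close>

lemma potential_nonincreasing:
  fixes \<phi> :: "'a \<Rightarrow> nat \<Rightarrow> nat"
  assumes "pair_graph G"
    and arc: "\<And>x y a b. (x, y) \<in> parcs G \<Longrightarrow> 2 \<le> a \<Longrightarrow> \<phi> x (a - 2) + \<phi> y (b + 1) \<le> \<phi> x a + \<phi> y b"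
    and "reach G p q"
  shows "(\<Sum>x\<in>pverts G. \<phi> x (q x)) \<le> (\<Sum>x\<in>pverts G. \<phi> x (p x))"
  using assms(3)
proof (induction rule: rtranclp_induct)
  case (step q q')
  interpret pair_graph G by fact
  from step.hyps(2) obtain x y where xy: "(x, y) \<in> parcs G" "2 \<le> q x"
    "q' = q(x := q x - 2, y := q y + 1)"
    by (auto simp: pebbling_move_def)
  have "x \<in> pverts G" "y \<in> pverts G - {x}"
    using xy(1) in_arcsD1 in_arcsD2 pair_no_loops by fastforce+
  then have split: "(\<Sum>z\<in>pverts G. \<phi> z (r z)) =
      \<phi> x (r x) + (\<phi> y (r y) + (\<Sum>z\<in>pverts G - {x} - {y}. \<phi> z (r z)))" for r
    using pair_finite_verts by (simp add: sum.remove)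
  have "(\<Sum>z\<in>pverts G - {x} - {y}. \<phi> z (q' z)) = (\<Sum>z\<in>pverts G - {x} - {y}. \<phi> z (q z))"
    by (rule sum.cong) (auto simp: xy(3))
  moreover have "\<phi> x (q' x) + \<phi> y (q' y) \<le> \<phi> x (q x) + \<phi> y (q y)"
    using arc[OF xy(1,2), of "q y"] \<open>y \<in> _\<close> by (auto simp: xy(3))
  ultimately show ?case
    using step.IH split[of q] split[of q'] by linarith
qed simp

text \<open>
  A single pebble on an original vertex \<open>x\<close> is useless, because the neighbours of \<open>x\<close> are pairwise
  adjacent; hence only pairs of pebbles on \<open>x\<close> count, each as much as a pebble on the best neighbour.
\<close>

lemma middle_graph_potential:
  fixes \<delta> :: "'a \<Rightarrow> nat" and d :: nat
  defines "\<phi> \<equiv> \<lambda>r. case_sum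
      (\<lambda>x a. if x = r then 2 ^ (d + 1) * a else 2 ^ (d + 1 - \<delta> x) * (a div 2))
      (\<lambda>e a. 2 ^ (d - Min (\<delta> ` e)) * a)"
  assumes "pair_graph G" "\<delta> r = 0"
    and lip: "\<And>x y. (x, y) \<in> parcs G \<Longrightarrow> \<delta> x \<le> \<delta> y + 1 \<and> \<delta> y \<le> \<delta> x + 1"
    and "reach (middle_graph G) p q"
  shows "(\<Sum>x\<in>pverts (middle_graph G). \<phi> r x (q x)) \<le> (\<Sum>x\<in>pverts (middle_graph G). \<phi> r x (p x))"
proof (rule potential_nonincreasing[OF pair_graph_middle_graph[OF \<open>pair_graph G\<close>] _ assms(5)])
  have edge: "Min (\<delta> ` e) \<le> \<delta> x" "\<delta> x \<le> Min (\<delta> ` e) + 1" if "e \<in> edge_sets G" "x \<in> e" for e x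
  proof -
    from that(1) obtain a b where e: "e = {a, b}" "(a, b) \<in> parcs G"
      by (auto simp: edge_sets_def)
    then show "Min (\<delta> ` e) \<le> \<delta> x" "\<delta> x \<le> Min (\<delta> ` e) + 1"
      using that(2) lip[OF e(2)] by (auto simp: min_def)
  qed
  fix x y :: "'a + 'a set" and a b :: nat
  assume xy: "(x, y) \<in> parcs (middle_graph G)" and a: "2 \<le> a"
  have half: "a div 2 = (a - 2) div 2 + 1" "(b + 1) div 2 \<le> b div 2 + 1"
    using a by presburger+
  consider v e where "x = Inl v" "y = Inr e" "e \<in> edge_sets G" "v \<in> e"
    | v e where "x = Inr e" "y = Inl v" "e \<in> edge_sets G" "v \<in> e"
    | e e' v where "x = Inr e" "y = Inr e'" "e \<in> edge_sets G" "e' \<in> edge_sets G" "v \<in> e" "v \<in> e'"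
    using xy by (simp add: middle_graph_def) blast
  then show "\<phi> r x (a - 2) + \<phi> r y (b + 1) \<le> \<phi> r x a + \<phi> r y b"
  proof cases
    case 1
    have "(2::nat) ^ (d - Min (\<delta> ` e)) \<le> 2 ^ (d + 1 - \<delta> v)"
      by (rule power_increasing) (use edge(2)[OF 1(3,4)] in auto)
    \<comment> \<open>This covers \<open>v = r\<close>, where single pebbles count instead of
      pairs.\<close>
    moreover have "(2::nat) ^ (d + 1) * (a - 2) + 2 ^ (d - Min (\<delta> ` e)) \<le> 2 ^ (d + 1) * a"
    proof -
      have "(2::nat) ^ (d - Min (\<delta> ` e)) \<le> 2 ^ (d + 1)"
        by (rule power_increasing) auto
      moreover have "(2::nat) ^ (d + 1) * (a - 2 + 1) \<le> 2 ^ (d + 1) * a"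
        by (rule mult_le_mono2) (use a in simp)
      ultimately show ?thesis unfolding distrib_left by linarith
    qed
    ultimately show ?thesis
      using 1(1,2) unfolding \<phi>_def by (auto simp: half(1) distrib_left simp del: power_Suc)
  next
    case 2
    have le: "(2::nat) ^ (d + 1 - \<delta> v) \<le> 2 ^ (d - Min (\<delta> ` e) + 1)"
      by (rule power_increasing) (use edge(1)[OF 2(3,4)] in auto)
    moreover have "(2::nat) ^ (d + 1 - \<delta> v) * ((b + 1) div 2) \<le>
        2 ^ (d + 1 - \<delta> v) * (b div 2) + 2 ^ (d - Min (\<delta> ` e) + 1)"
    proof -
      have "(2::nat) ^ (d + 1 - \<delta> v) * ((b + 1) div 2) \<le> 2 ^ (d + 1 - \<delta> v) * (b div 2 + 1)"
        by (rule mult_le_mono2) (rule half(2))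
      then show ?thesis using le unfolding distrib_left by linarith
    qed
    moreover have "(2::nat) ^ (d - Min (\<delta> ` e)) * a = 2 ^ (d - Min (\<delta> ` e)) * (a - 2) + 2 ^ (d - Min (\<delta> ` e) + 1)"
      using a by (auto simp: algebra_simps le_iff_add)
    moreover have "v = r \<Longrightarrow> \<delta> v = 0" using \<open>\<delta> r = 0\<close> by simp
    ultimately show ?thesis
      using 2(1,2) unfolding \<phi>_def by (auto simp: distrib_left simp del: power_Suc)
  next
    case 3
    \<comment> \<open>Through the common endpoint \<open>v\<close>, the minimum over
      \<open>e\<close> exceeds the one over \<open>e'\<close> by at most one.\<close>
    have "(2::nat) ^ (d - Min (\<delta> ` e')) \<le> 2 ^ (d - Min (\<delta> ` e) + 1)"
      by (rule power_increasing) (use edge(1)[OF 3(3,5)] edge(2)[OF 3(4,6)] in auto)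
    moreover have "(2::nat) ^ (d - Min (\<delta> ` e)) * a = 2 ^ (d - Min (\<delta> ` e)) * (a - 2) + 2 ^ (d - Min (\<delta> ` e) + 1)"
      using a by (auto simp: algebra_simps le_iff_add)
    ultimately show ?thesis
      using 3(1,2) unfolding \<phi>_def by (auto simp: distrib_left simp del: power_Suc)
  qed
qed

text \<open>Place \<open>2 ^ (n + 1) - 1\<close> pebbles opposite the target and one on each other
  original vertex except the target. The single pebbles have potential \<open>0\<close>, and the odd
  pile has \<open>2 ^ n - 1\<close> pairs of potential \<open>2\<close> each, short of the
  \<open>2 ^ (n + 1)\<close> of a pebble on the target.\<close>

lemma middle_cycle_unsolvable:
  assumes "2 \<le> n"
  shows "\<exists>p. distribution (middle_graph (cycle_graph (2 * n))) (2 ^ (n + 1) + 2 * n - 3) p \<and>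
    \<not> can_reach (middle_graph (cycle_graph (2 * n))) p (Inl 0)"
proof -
  let ?C = "cycle_graph (2 * n)"
  let ?M = "middle_graph ?C"
  \<comment> \<open>The distance from \<open>0\<close> in the cycle.\<close>
  let ?\<delta> = "\<lambda>i. min i (2 * n - i)"
  let ?\<phi> = "case_sum
      (\<lambda>x a. if x = 0 then 2 ^ (n + 1) * a else 2 ^ (n + 1 - ?\<delta> x) * (a div 2))
      (\<lambda>e a. 2 ^ (n - Min (?\<delta> ` e)) * a) :: nat + nat set \<Rightarrow> nat \<Rightarrow> nat"
  define p :: "nat + nat set \<Rightarrow> nat" where
    "p = case_sum (\<lambda>i. if i = 0 \<or> 2 * n \<le> i then 0 else if i = n then 2 ^ (n + 1) - 1 else 1) (\<lambda>_. 0)"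
  have C: "pair_graph ?C"
    by (rule pair_graph_cycle_graph) (use assms in simp)
  interpret C: pair_graph ?C by (rule C)
  interpret M: pair_graph ?M by (rule pair_graph_middle_graph[OF C])
  have verts: "pverts ?M = Inl ` {..<2 * n} \<union> Inr ` edge_sets ?C"
    by (simp add: middle_graph_def cycle_graph_def)
  have fin: "finite (Inr ` edge_sets ?C :: (nat + nat set) set)"
    using M.pair_finite_verts verts by (metis finite_Un)
  have sum_verts: "(\<Sum>x\<in>pverts ?M. f x (p x)) = (\<Sum>i<2 * n. f (Inl i) (p (Inl i)))"
    if "\<And>e. f (Inr e) 0 = 0" for f :: "nat + nat set \<Rightarrow> nat \<Rightarrow> nat"
  proof -
    have "(\<Sum>x\<in>Inr ` edge_sets ?C. f x (p x)) = 0"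
      by (rule sum.neutral) (auto simp: p_def that)
    then show ?thesis
      unfolding verts using fin by (subst sum.union_disjoint) (auto simp: sum.reindex)
  qed
  have split: "{..<2 * n} = insert 0 (insert n ({..<2 * n} - {0, n}))"
    using assms by auto
  have lip: "?\<delta> x \<le> ?\<delta> y + 1 \<and> ?\<delta> y \<le> ?\<delta> x + 1" if "(x, y) \<in> parcs ?C" for x y
    using that by (auto simp: cycle_graph_def mod_Suc split: if_splits)
  have "(\<Sum>x\<in>pverts ?M. p x) = (\<Sum>i<2 * n. p (Inl i))"
    by (rule sum_verts[of "\<lambda>_ a. a"]) simp
  also have "\<dots> = (2 ^ (n + 1) - 1) + (\<Sum>i\<in>{..<2 * n} - {0, n}. p (Inl i))"
    using assms by (subst split) (simp add: p_def)
  also have "(\<Sum>i\<in>{..<2 * n} - {0, n}. p (Inl i)) = (\<Sum>i\<in>{..<2 * n} - {0, n}. 1)"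
    by (rule sum.cong) (auto simp: p_def)
  also have "\<dots> = 2 * n - 2"
    using assms by (simp add: card_Diff_subset)
  finally have "(\<Sum>x\<in>pverts ?M. p x) = 2 ^ (n + 1) + 2 * n - 3"
    using assms by simp
  moreover have "p x = 0" if "x \<notin> pverts ?M" for x
    using that by (cases x) (auto simp: p_def verts)
  ultimately have "distribution ?M (2 ^ (n + 1) + 2 * n - 3) p"
    by (simp add: distribution_def)
  moreover have "\<not> can_reach ?M p (Inl 0)"
  proof
    assume "can_reach ?M p (Inl 0)"
    then obtain q where q: "reach ?M p q" "1 \<le> q (Inl 0)"
      by (auto simp: can_reach_def)
    have "(2::nat) ^ (n + 1) * 1 \<le> ?\<phi> (Inl 0) (q (Inl 0))"
      using q(2) by simp
    also have "\<dots> \<le> (\<Sum>x\<in>pverts ?M. ?\<phi> x (q x))"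
      by (rule member_le_sum) (use M.pair_finite_verts verts assms in auto)
    also have "\<dots> \<le> (\<Sum>x\<in>pverts ?M. ?\<phi> x (p x))"
      using middle_graph_potential[of ?C ?\<delta> 0 p q n, OF C _ lip q(1)] by simp
    also have "\<dots> = (\<Sum>i<2 * n. ?\<phi> (Inl i) (p (Inl i)))"
      by (rule sum_verts) simp
    also have "\<dots> = ?\<phi> (Inl n) (p (Inl n)) + (\<Sum>i\<in>{..<2 * n} - {0, n}. ?\<phi> (Inl i) (p (Inl i)))"
      using assms by (subst split) (simp add: p_def)
    also have "(\<Sum>i\<in>{..<2 * n} - {0, n}. ?\<phi> (Inl i) (p (Inl i))) = 0"
      by (rule sum.neutral) (auto simp: p_def)
    also have "?\<phi> (Inl n) (p (Inl n)) = 2 * ((2 ^ (n + 1) - 1) div 2)"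
      using assms by (simp add: p_def)
    finally have "(2::nat) ^ (n + 1) * 1 \<le> 2 * ((2 ^ (n + 1) - 1) div 2) + 0" .
    moreover have "(2::nat) * ((2 ^ (n + 1) - 1) div 2) \<le> 2 ^ (n + 1) - 1"
      by (rule times_div_less_eq_dividend)
    moreover have "(0::nat) < 2 ^ (n + 1)"
      by simp
    ultimately show False
      by linarith
  qed
  ultimately show ?thesis by blast
qed

section \<open>The product of two middle graphs\<close>

text \<open>Here \<open>K\<close> stands for \<open>2 ^ (m + 1)\<close> and \<open>X\<close> for
  \<open>2 ^ n\<close>. The estimate is tight: for \<open>m = n = 2\<close>, \<open>K = 8\<close>,
  \<open>X = 4\<close> the two sides are \<open>597\<close> and \<open>600\<close>.\<close>

lemma product_arith:
  fixes m n K X :: nat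
  assumes "2 \<le> m" "2 \<le> n" "4 * m \<le> K" "2 * n \<le> X"
  shows "3 * (X * (K + (2 * m - 2) - 1)) + 3 * (4 * m * (2 * X + 2 * (2 * n - 2) - 1)) +
    K * (4 * X + 2) + 9 * (K + (2 * m - 2) - 1) < 6 * ((2 * X + 2 * n - 2) * (K + 2 * m - 2))"
proof -
  \<comment> \<open>In terms of the slacks both sides are polynomials with nonnegative coefficients,
    and each coefficient on the left is at most its counterpart on the right.\<close>
  from assms obtain a b k x where "m = a + 2" "n = b + 2" and K: "K = 4 * m + k" and X: "X = 2 * n + x"
    by (metis add.commute le_Suc_ex)
  then have "2 * m - 2 = 2 * a + 2" "K + 2 * m - 2 = 6 * a + k + 10" "K + (2 * m - 2) - 1 = 6 * a + k + 9"
    "2 * X + 2 * (2 * n - 2) - 1 = 8 * b + 2 * x + 11" "2 * X + 2 * n - 2 = 6 * b + 2 * x + 10"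
    by auto
  then show ?thesis
    unfolding K X \<open>m = a + 2\<close> \<open>n = b + 2\<close> by (simp add: algebra_simps)
qed

lemma four_mult_le_power: "2 \<le> m \<Longrightarrow> 4 * m \<le> 2 ^ (m + 1)"
proof (induction m rule: dec_induct)
  case (step m)
  then show ?case by simp
qed simp

lemma product_solvable_at_E:
  assumes "sun G n V E" "sun H m V' E'" "s \<in> pverts H"
    and "(2 ^ (n + 1) + 2 * n - 2) * (2 ^ (m + 1) + 2 * m - 2) \<le> (\<Sum>z\<in>pverts (cart_prod G H). P z)"
  shows "can_reach (cart_prod G H) P (E i, s)"
proof (rule ccontr)
  assume unsolvable: "\<not> ?thesis"
  interpret G: sun G n "\<lambda>j. V (i + j)" "\<lambda>j. E (i + j)"
    by (rule sun.sun_shift) fact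
  interpret H: sun H m V' E' by fact
  have "2 * n \<le> 2 ^ n"
    using four_mult_le_power[OF G.two_le] by simp
  then have "3 * (2 ^ n * (2 ^ (m + 1) + (2 * m - 2) - 1)) +
      3 * (4 * m * (2 * 2 ^ n + 2 * (2 * n - 2) - 1)) +
      2 ^ (m + 1) * (4 * 2 ^ n + 2) + 9 * (2 ^ (m + 1) + (2 * m - 2) - 1)
      < 6 * ((2 * 2 ^ n + 2 * n - 2) * (2 ^ (m + 1) + 2 * m - 2))"
    by (intro product_arith G.two_le H.two_le four_mult_le_power)
  moreover have "6 * (\<Sum>z\<in>pverts (cart_prod G H). P z) \<le>
      3 * (2 ^ n * (2 ^ (m + 1) + (2 * m - 2) - 1)) +
      3 * (card (pverts H) * (2 ^ (n + 1) + 2 * (2 * n - 2) - 1)) +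
      2 ^ (m + 1) * (2 ^ (n + 2) + 2) + 9 * (2 ^ (m + 1) + (2 * m - 2) - 1)"
    by (rule G.unsolvable_product_bound[OF H.finite_verts assms(3) _ H.many_pebbles[OF assms(3)]])
      (use unsolvable in simp_all)
  ultimately show False
    using mult_le_mono2[OF assms(4), of 6] by (simp add: H.card_verts)
qed

lemma sun_middle_cycle:
  assumes "2 \<le> n"
  shows "sun (middle_graph (cycle_graph (2 * n))) n (\<lambda>i. Inl (nat (i mod (2 * int n))))
    (\<lambda>i. Inr {nat (i mod (2 * int n)), nat ((i + 1) mod (2 * int n))})"
proof -
  define c where "c i = nat (i mod (2 * int n))" for i
  have c_less: "c i < 2 * n" for i
    using assms by (simp add: c_def nat_less_iff)
  have int_c: "int (c i) = i mod (2 * int n)" for i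
    using assms by (simp add: c_def)
  have c_eq: "c i = c j \<longleftrightarrow> i mod (2 * int n) = j mod (2 * int n)" for i j
    by (metis int_c of_nat_eq_iff)
  have c_Suc: "c (i + 1) = Suc (c i) mod (2 * n)" for i
  proof -
    have "int (c (i + 1)) = (int (c i) + 1) mod (2 * int n)"
      by (simp add: int_c mod_add_left_eq)
    also have "\<dots> = int (Suc (c i) mod (2 * n))"
      by (simp add: zmod_int add.commute)
    finally show ?thesis by simp
  qed
  have c_int: "c (int x) = x" if "x < 2 * n" for x
    using that by (simp add: c_def)
  have range_c: "range c = {..<2 * n}"
  proof (intro equalityI subsetI)
    fix x assume "x \<in> {..<2 * n}"
    then show "x \<in> range c"
      using c_int[of x] by (metis lessThan_iff rangeI)
  qed (use c_less in auto)
  have edges: "edge_sets (cycle_graph (2 * n)) = range (\<lambda>i. {c i, c (i + 1)})"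
  proof (intro equalityI subsetI)
    fix e assume "e \<in> edge_sets (cycle_graph (2 * n))"
    then obtain x where "x < 2 * n" "e = {x, Suc x mod (2 * n)}"
      by (auto simp: edge_sets_def cycle_graph_def doubleton_eq_iff)
    then have "e = {c (int x), c (int x + 1)}"
      by (simp add: c_Suc c_int)
    then show "e \<in> range (\<lambda>i. {c i, c (i + 1)})" by blast
  next
    fix e assume "e \<in> range (\<lambda>i. {c i, c (i + 1)})"
    then obtain i where "e = {c i, Suc (c i) mod (2 * n)}"
      by (auto simp: c_Suc)
    then show "e \<in> edge_sets (cycle_graph (2 * n))"
      using c_less[of i] assms unfolding edge_sets_def cycle_graph_def by fastforce
  qed
  \<comment> \<open>The cycle has more than two vertices, so an edge determines which endpoint comes
    first.\<close>
  have c_edge_eq: "{c i, c (i + 1)} = {c j, c (j + 1)} \<longleftrightarrow> c i = c j" for i j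
    using c_less[of i] c_less[of j] assms
    by (auto simp: doubleton_eq_iff c_Suc mod_Suc split: if_splits)
  have c_neq: "c i \<noteq> c (i + 1)" for i
    using c_less[of i] assms by (auto simp: c_Suc mod_Suc)
  have edge_neq: "{c i, c (i + 1)} \<noteq> {c (i + 1), c (i + 1 + 1)}" for i
    using c_edge_eq[of i "i + 1"] c_neq[of i] by simp
  have "sun (middle_graph (cycle_graph (2 * n))) n (\<lambda>i. Inl (c i)) (\<lambda>i. Inr {c i, c (i + 1)})"
  proof
    have "pverts (middle_graph (cycle_graph (2 * n))) =
        Inl ` range c \<union> Inr ` range (\<lambda>i. {c i, c (i + 1)})"
      by (simp only: range_c edges middle_graph_def cycle_graph_def pair_pre_digraph.simps)
        (simp add: edges[unfolded cycle_graph_def])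
    then show "pverts (middle_graph (cycle_graph (2 * n))) =
        range (\<lambda>i. Inl (c i)) \<union> range (\<lambda>i. Inr {c i, c (i + 1)})"
      by (simp add: image_image)
  qed (use assms c_edge_eq edge_neq edge_neq[symmetric] in \<open>auto simp: middle_graph_def edges c_eq\<close>)
  then show ?thesis by (simp add: c_def)
qed

lemma pebbling_number_middle_cycle_ge:
  assumes "2 \<le> n"
  shows "2 ^ (n + 1) + 2 * n - 2 \<le> pebbling_number (middle_graph (cycle_graph (2 * n)))"
proof -
  let ?M = "middle_graph (cycle_graph (2 * n))"
  interpret sun ?M n "\<lambda>i. Inl (nat (i mod (2 * int n)))"
    "\<lambda>i. Inr {nat (i mod (2 * int n)), nat ((i + 1) mod (2 * int n))}"
    by (rule sun_middle_cycle[OF assms])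
  have zero: "Inl 0 \<in> pverts ?M"
    using assms by (simp add: middle_graph_def cycle_graph_def)
  let ?P = "\<lambda>N. \<forall>p. distribution ?M N p \<longrightarrow> can_reach ?M p (Inl 0)"
  \<comment> \<open>Some number must be known to suffice before \<open>LEAST\<close> yields a
    sufficient one.\<close>
  have "?P (2 ^ (n + 1) * 1 + (2 * n - 2))"
  proof (intro allI impI)
    fix p assume "distribution ?M (2 ^ (n + 1) * 1 + (2 * n - 2)) p"
    then have "2 ^ (n + 1) * 1 + (2 * n - 2) \<le> (\<Sum>x\<in>pverts ?M. p x)"
      by (simp add: distribution_def)
    from many_pebbles[OF zero this] show "can_reach ?M p (Inl 0)"
      by (auto simp: can_reach_def)
  qed
  then have least: "?P (pebbling_number_at ?M (Inl 0))"
    unfolding pebbling_number_at_def by (rule LeastI)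
  have "2 ^ (n + 1) + 2 * n - 3 < pebbling_number_at ?M (Inl 0)"
  proof (rule ccontr)
    assume "\<not> ?thesis"
    then show False
      using middle_cycle_unsolvable[OF assms] can_reach_more[OF finite_verts, of _ "Inl 0"] least
      by (metis not_less)
  qed
  also have "\<dots> \<le> pebbling_number ?M"
    unfolding pebbling_number_def by (rule Max_ge) (use finite_verts zero in auto)
  finally show ?thesis by simp
qed

theorem theorem3p2:
  fixes n m :: nat and u v :: "nat + nat set"
  assumes "2 \<le> n" and "2 \<le> m"
    and "(u, v) \<in> pverts (cart_prod (middle_graph (cycle_graph (2 * n)))
                                     (middle_graph (cycle_graph (2 * m))))"
    and "(u, v) \<notin> map_prod Inl Inl ` pverts (cart_prod (cycle_graph (2 * n)) (cycle_graph (2 * m)))"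
  shows "pebbling_number_at
           (cart_prod (middle_graph (cycle_graph (2 * n))) (middle_graph (cycle_graph (2 * m)))) (u, v)
         \<le> pebbling_number (middle_graph (cycle_graph (2 * n))) *
           pebbling_number (middle_graph (cycle_graph (2 * m)))"
proof -
  let ?G = "middle_graph (cycle_graph (2 * n))" and ?H = "middle_graph (cycle_graph (2 * m))"
  let ?E = "\<lambda>n i. Inr {nat (i mod (2 * int n)), nat ((i + 1) mod (2 * int n))} :: nat + nat set"
  let ?N = "pebbling_number ?G * pebbling_number ?H"
  note G = sun_middle_cycle[OF assms(1)] and H = sun_middle_cycle[OF assms(2)]
  have uv: "u \<in> pverts ?G" "v \<in> pverts ?H"
    using assms(3) by (simp_all add: cart_prod_def)
  have "(\<exists>i. u = ?E n i) \<or> (\<exists>i. v = ?E m i)"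
  proof (rule ccontr)
    assume "\<not> ?thesis"
    then obtain x y where "u = Inl x" "v = Inl y"
      using uv sun.verts[OF G] sun.verts[OF H] by auto
    then have "(u, v) \<in> map_prod Inl Inl ` pverts (cart_prod (cycle_graph (2 * n)) (cycle_graph (2 * m)))"
      using uv by (auto simp: cart_prod_def middle_graph_def)
    with assms(4) show False by contradiction
  qed
  moreover have "can_reach (cart_prod ?G ?H) p (u, v)"
    if p: "distribution (cart_prod ?G ?H) ?N p" and E: "(\<exists>i. u = ?E n i) \<or> (\<exists>i. v = ?E m i)" for p
  proof -
    \<comment> \<open>Only the lower bounds on the two pebbling numbers enter here.\<close>
    have sum: "(2 ^ (n + 1) + 2 * n - 2) * (2 ^ (m + 1) + 2 * m - 2) \<le> (\<Sum>z\<in>pverts (cart_prod ?G ?H). p z)"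
      using p mult_le_mono[OF pebbling_number_middle_cycle_ge[OF assms(1)]
          pebbling_number_middle_cycle_ge[OF assms(2)]]
      by (simp add: distribution_def)
    from E show ?thesis
    proof (elim disjE exE)
      fix i assume "u = ?E n i"
      then show ?thesis
        using product_solvable_at_E[OF G H uv(2) sum, of i] by simp
    next
      fix i assume "v = ?E m i"
      \<comment> \<open>If \<open>v\<close> is the inserted coordinate, the factors exchange
        roles.\<close>
      have "(\<Sum>z\<in>pverts (cart_prod ?G ?H). p z) = (\<Sum>z\<in>pverts (cart_prod ?H ?G). (p \<circ> prod.swap) z)"
        by (rule sum.reindex_bij_witness[where i = prod.swap and j = prod.swap])
          (auto simp: cart_prod_def)
      with sum have "(2 ^ (m + 1) + 2 * m - 2) * (2 ^ (n + 1) + 2 * n - 2) \<le>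
          (\<Sum>z\<in>pverts (cart_prod ?H ?G). (p \<circ> prod.swap) z)"
        by (simp only: mult.commute)
      from product_solvable_at_E[OF H G uv(1) this, of i] \<open>v = ?E m i\<close>
      have "can_reach (cart_prod ?H ?G) (p \<circ> prod.swap) (v, u)"
        by (simp add: comp_def)
      from can_reach_swap[OF this] show ?thesis
        by (simp add: comp_assoc)
    qed
  qed
  ultimately show ?thesis
    unfolding pebbling_number_at_def by (intro Least_le) blast
qed

end
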